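(* Let $n\ge 2$ be an integer. The cozero-divisor graph $\Gamma'(\mathbb{Z}_n[x]/(x^2))$ is disconnected if and only if $n$ is a prime power (i.e. $n=p^k$ with $p$ prime and $k\ge 1$).
   Context: For a commutative ring $R$ with nonzero identity, the cozero-divisor graph $\Gamma'(R)$ is the simple undirected graph whose vertices are the nonzero non-unit elements of $R$, with two distinct vertices $u,v$ adjacent if and only if $u\notin Rv$ and $v\notin Ru$. $\mathbb{Z}_n$ denotes the ring of integers modulo $n$.
   Formalization: The equivalence is stated for n ≠ 2 only; for n = 2 the graph is a single vertex (the class of x), which is connected in the usual sense although 2 is a prime power, so there the formal statement says only that the graph has exactly one vertex. *)

theory Defs
  imports
    "HOL-Algebra.QuotRing"
    "HOL-Algebra.UnivPoly"
    "HOL-Number_Theory.Residues"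
    "Graph_Theory.Pair_Digraph"
    "Graph_Theory.Digraph_Component"
begin

text \<open>
  An undirected graph is represented, as usual in \<^verbatim>\<open>Graph_Theory\<close>, by a symmetric arc relation.
  The principal ideal \<^term>\<open>PIdl\<^bsub>R\<^esub> v\<close> is by definition the set \<open>Rv\<close> of multiples of \<open>v\<close>.
\<close>

definition cozero_divisor_graph :: "('a, 'm) ring_scheme \<Rightarrow> 'a pair_pre_digraph" where
  "cozero_divisor_graph R =
    (let V = carrier R - {\<zero>\<^bsub>R\<^esub>} - Units R
     in \<lparr> pverts = V,
          parcs = {(u, v). u \<in> V \<and> v \<in> V \<and> u \<noteq> v \<and>
                     u \<notin> PIdl\<^bsub>R\<^esub> v \<and> v \<notin> PIdl\<^bsub>R\<^esub> u} \<rparr>)"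

definition Zn_poly_mod_x2 :: "nat \<Rightarrow> (nat \<Rightarrow> int) set ring" where
  "Zn_poly_mod_x2 n =
    (let P = UP (residue_ring (int n))
     in P Quot (PIdl\<^bsub>P\<^esub> (monom P \<one>\<^bsub>residue_ring (int n)\<^esub> 2)))"

text \<open>
  The name \<open>connected\<close> also denotes a topological notion.  In the graph-theoretic sense the graph
  with exactly one vertex is connected.  This matters for \<open>n = 2\<close>: the only nonzero non-unit of
  \<open>\<int>\<^sub>2[x]/(x\<^sup>2)\<close> is the class of \<open>x\<close>.
\<close>

abbreviation graph_connected :: "'a pair_pre_digraph \<Rightarrow> bool" where
  "graph_connected G \<equiv> Digraph_Component.connected (with_proj G)"

end

theory Submission
  imports Defs
begin

text \<open>
  The ring \<open>\<int>\<^sub>n[x]/(x\<^sup>2)\<close> is the ring of dual numbers \<open>a + b\<epsilon>\<close> over \<open>\<int>\<^sub>n\<close>. If \<open>n\<close> is not a prime power,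
  the Chinese remainder theorem gives an idempotent \<open>e\<close> other than \<open>0\<close> and \<open>1\<close>; then \<open>e\<close> and \<open>1 - e\<close>
  are adjacent and every vertex is adjacent to one of them. If \<open>n = p\<^sup>k\<close>, the element \<open>p\<^sup>k\<^sup>-\<^sup>1\<epsilon>\<close> is a
  multiple of every nonzero element, hence an isolated vertex, and it is the only vertex just for \<open>n = 2\<close>.
\<close>

section \<open>Connectedness of cozero-divisor graphs\<close>

lemma pverts_cozero_divisor_graph:
  "pverts (cozero_divisor_graph R) = carrier R - {\<zero>\<^bsub>R\<^esub>} - Units R"
  by (simp add: cozero_divisor_graph_def)

lemma parcs_cozero_divisor_graph:
  "(u, v) \<in> parcs (cozero_divisor_graph R) \<longleftrightarrow>
     u \<in> carrier R - {\<zero>\<^bsub>R\<^esub>} - Units R \<and> v \<in> carrier R - {\<zero>\<^bsub>R\<^esub>} - Units R \<and> u \<noteq> v \<and>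
     u \<notin> PIdl\<^bsub>R\<^esub> v \<and> v \<notin> PIdl\<^bsub>R\<^esub> u"
  by (simp add: cozero_divisor_graph_def Let_def)

lemma (in monoid) idempotent_Unit_eq_one:
  assumes "e \<in> Units G" "e \<otimes> e = e"
  shows "e = \<one>"
  using assms by (metis Units_closed Units_l_cancel one_closed r_one)

lemma (in ring) square_zero_not_Unit:
  assumes "s \<in> carrier R" "s \<otimes> s = \<zero>" "s \<noteq> \<zero>"
  shows "s \<notin> Units R"
  using assms by (metis Units_l_cancel r_null zero_closed)

lemma mk_symmetric_with_proj:
  assumes "sym (parcs G)"
  shows "mk_symmetric (with_proj G) = G"
  using assms by (cases G) (auto simp: mk_symmetric_def sym_def)

text \<open>\<open>connected\<close> means strong connectivity of the symmetric closure, and the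
  adjacency relation is already symmetric.\<close>

lemma graph_connected_cozero_divisor_graph_iff:
  "graph_connected (cozero_divisor_graph R) \<longleftrightarrow>
     strongly_connected (with_proj (cozero_divisor_graph R))"
proof -
  have "sym (parcs (cozero_divisor_graph R))"
    by (auto simp: sym_def parcs_cozero_divisor_graph)
  then show ?thesis
    by (simp add: Digraph_Component.connected_def mk_symmetric_with_proj)
qed

text \<open>The case split is on \<open>w \<otimes> f\<close>. If it is zero, then
  \<open>w = w \<otimes> e\<close>, and \<open>w\<close> and \<open>f\<close> annihilate each other,
  so neither nonzero element is a multiple of the other. Otherwise \<open>w\<close> is no multiple
  of \<open>e\<close>, since \<open>f\<close> annihilates those, and the last assumption is the
  other half of adjacency to \<open>e\<close>.\<close>

lemma (in cring) complementary_idempotents_adjacent: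
  assumes e: "e \<in> pverts (cozero_divisor_graph R)" and f: "f \<in> pverts (cozero_divisor_graph R)"
    and ef: "e \<oplus> f = \<one>" "e \<otimes> f = \<zero>"
    and w: "w \<in> pverts (cozero_divisor_graph R)" "e \<notin> PIdl w"
  shows "(w, e) \<in> parcs (cozero_divisor_graph R) \<or> (w, f) \<in> parcs (cozero_divisor_graph R)"
proof -
  have carr: "e \<in> carrier R" "f \<in> carrier R" "w \<in> carrier R"
    and nz: "f \<noteq> \<zero>" "w \<noteq> \<zero>"
    using e f w by (auto simp: pverts_cozero_divisor_graph)
  \<comment> \<open>This supplies distinctness: an element outside \<open>PIdl w\<close> cannot
    equal \<open>w\<close>.\<close>
  have w_self: "w \<in> PIdl w" by (rule cgenideal_self[OF carr(3)])
  show ?thesis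
  proof (cases "w \<otimes> f = \<zero>")
    case True
    have "w = w \<otimes> e"
      using True carr ef(1) by (metis m_closed r_distr r_one r_zero)
    have "w \<notin> PIdl f"
    proof
      assume "w \<in> PIdl f"
      then obtain y where "y \<in> carrier R" "w = y \<otimes> f"
        by (auto simp: cgenideal_def)
      then have "w \<otimes> e = \<zero>"
        using carr ef(2) by (metis m_assoc m_comm r_null)
      then show False using \<open>w = w \<otimes> e\<close> nz by simp
    qed
    moreover have "f \<notin> PIdl w"
    proof
      assume "f \<in> PIdl w"
      then obtain y where "y \<in> carrier R" "f = y \<otimes> w"
        by (auto simp: cgenideal_def)
      then have "f \<otimes> f = \<zero>"
        using True carr by (metis m_assoc r_null)
      moreover have "f \<otimes> f = f"
        using carr ef by (metis l_distr l_one l_zero m_closed)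
      ultimately show False using nz by simp
    qed
    ultimately show ?thesis
      using w f w_self by (auto simp: parcs_cozero_divisor_graph pverts_cozero_divisor_graph)
  next
    case False
    have "w \<notin> PIdl e"
      using False carr ef(2) by (auto simp: cgenideal_def m_assoc)
    then show ?thesis
      using w e w_self by (auto simp: parcs_cozero_divisor_graph pverts_cozero_divisor_graph)
  qed
qed

lemma (in cring) cozero_divisor_graph_connected:
  assumes e: "e \<in> carrier R" "e \<otimes> e = e" "e \<noteq> \<zero>" "e \<noteq> \<one>"
  shows "graph_connected (cozero_divisor_graph R)"
proof -
  let ?G = "cozero_divisor_graph R"
  interpret G: pair_wf_digraph ?G
    by unfold_locales (auto simp: parcs_cozero_divisor_graph pverts_cozero_divisor_graph)
  define f where "f = \<one> \<ominus> e"
  have f: "f \<in> carrier R" "e \<oplus> f = \<one>"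
    using e(1) by (simp_all add: f_def) algebra
  have ef: "e \<otimes> f = \<zero>"
    using e(1,2) by (simp add: f_def a_minus_def r_distr r_minus r_neg)
  have ff: "f \<otimes> f = f"
    using e f ef by (metis l_distr l_one l_zero m_closed)
  have f01: "f \<noteq> \<zero>" "f \<noteq> \<one>"
    using e f ef by (metis r_zero, metis r_one)
  have Ve: "e \<in> pverts ?G" and Vf: "f \<in> pverts ?G"
    using e f f01 ff idempotent_Unit_eq_one by (auto simp: pverts_cozero_divisor_graph)
  have adj: "(w, e) \<in> parcs ?G \<or> (w, f) \<in> parcs ?G" if w: "w \<in> pverts ?G" for w
  proof -
    have wc: "w \<in> carrier R" "w \<noteq> \<zero>" "w \<notin> Units R"
      using w by (auto simp: pverts_cozero_divisor_graph)
    \<comment> \<open>If \<open>w\<close> divided both idempotents, it would divide their sum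
      \<open>\<one>\<close> and be a unit.\<close>
    have "e \<notin> PIdl w \<or> f \<notin> PIdl w"
    proof (rule ccontr)
      assume "\<not> ?thesis"
      then obtain x y where "x \<in> carrier R" "e = x \<otimes> w" "y \<in> carrier R" "f = y \<otimes> w"
        by (auto simp: cgenideal_def)
      then have "(x \<oplus> y) \<otimes> w = \<one>" "x \<oplus> y \<in> carrier R"
        using f wc by (auto simp: l_distr)
      then show False
        using wc by (auto simp: Units_def m_comm)
    qed
    \<comment> \<open>With these the adjacency lemma also applies with \<open>e\<close> and
      \<open>f\<close> exchanged.\<close>
    moreover have "f \<oplus> e = \<one>" "f \<otimes> e = \<zero>"
      using e f ef by (simp_all add: a_comm m_comm)
    ultimately show ?thesis
      using complementary_idempotents_adjacent Ve Vf f(2) ef w by blast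
  qed
  have arc_sym: "(v, u) \<in> parcs ?G" if "(u, v) \<in> parcs ?G" for u v
    using that by (auto simp: parcs_cozero_divisor_graph)
  \<comment> \<open>There are no loops, so the neighbour of \<open>f\<close> among \<open>e\<close>
    and \<open>f\<close> is \<open>e\<close>. Every vertex then reaches \<open>e\<close> directly or
    through \<open>f\<close>.\<close>
  have fe: "(f, e) \<in> parcs ?G"
    using adj[OF Vf] by (auto simp: parcs_cozero_divisor_graph)
  have to_e: "w \<rightarrow>\<^sup>*\<^bsub>with_proj ?G\<^esub> e" and from_e: "e \<rightarrow>\<^sup>*\<^bsub>with_proj ?G\<^esub> w" if "w \<in> pverts ?G" for w
    using adj[OF that] fe arc_sym
    by (meson G.reachable_adjI G.reachable_trans)+
  show ?thesis
    unfolding graph_connected_cozero_divisor_graph_iff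
    using Ve G.reachable_trans[OF to_e from_e] by (intro strongly_connectedI) auto
qed

text \<open>A multiple of every nonzero element is adjacent to nothing; \<open>t\<close> is the
  second vertex that makes an isolated vertex disconnect the graph.\<close>

lemma cozero_divisor_graph_not_connected:
  fixes R (structure)
  assumes s: "s \<in> carrier R - {\<zero>} - Units R"
    and t: "t \<in> carrier R - {\<zero>} - Units R" "t \<noteq> s"
    and least: "\<And>v. v \<in> carrier R \<Longrightarrow> v \<noteq> \<zero> \<Longrightarrow> s \<in> PIdl v"
  shows "\<not> graph_connected (cozero_divisor_graph R)"
proof
  let ?G = "cozero_divisor_graph R"
  interpret G: pair_wf_digraph ?G
    by unfold_locales (auto simp: parcs_cozero_divisor_graph pverts_cozero_divisor_graph)
  assume "graph_connected ?G"
  then have "s \<rightarrow>\<^sup>*\<^bsub>with_proj ?G\<^esub> t"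
    using s t by (auto simp: graph_connected_cozero_divisor_graph_iff strongly_connected_def
        pverts_cozero_divisor_graph)
  \<comment> \<open>Since \<open>t\<close> differs from \<open>s\<close>, the walk would start with
    an arc leaving \<open>s\<close>.\<close>
  then show False
    using t(2) least
    by (cases rule: G.converse_reachable_cases) (auto simp: parcs_cozero_divisor_graph)
qed

section \<open>Dual numbers\<close>

text \<open>Pairs replace cosets of polynomials, so that multiples, units and idempotents can be
  computed by components.\<close>

definition dual_numbers :: "('a, 'm) ring_scheme \<Rightarrow> ('a \<times> 'a) ring" where
  "dual_numbers R =
    \<lparr> carrier = carrier R \<times> carrier R,
      monoid.mult = \<lambda>u v. (fst u \<otimes>\<^bsub>R\<^esub> fst v, (fst u \<otimes>\<^bsub>R\<^esub> snd v) \<oplus>\<^bsub>R\<^esub> (snd u \<otimes>\<^bsub>R\<^esub> fst v)),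
      one = (\<one>\<^bsub>R\<^esub>, \<zero>\<^bsub>R\<^esub>),
      zero = (\<zero>\<^bsub>R\<^esub>, \<zero>\<^bsub>R\<^esub>),
      add = \<lambda>u v. (fst u \<oplus>\<^bsub>R\<^esub> fst v, snd u \<oplus>\<^bsub>R\<^esub> snd v) \<rparr>"

lemma dual_numbers_simps [simp]:
  "carrier (dual_numbers R) = carrier R \<times> carrier R"
  "u \<otimes>\<^bsub>dual_numbers R\<^esub> v = (fst u \<otimes>\<^bsub>R\<^esub> fst v, (fst u \<otimes>\<^bsub>R\<^esub> snd v) \<oplus>\<^bsub>R\<^esub> (snd u \<otimes>\<^bsub>R\<^esub> fst v))"
  "\<one>\<^bsub>dual_numbers R\<^esub> = (\<one>\<^bsub>R\<^esub>, \<zero>\<^bsub>R\<^esub>)"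
  "\<zero>\<^bsub>dual_numbers R\<^esub> = (\<zero>\<^bsub>R\<^esub>, \<zero>\<^bsub>R\<^esub>)"
  "u \<oplus>\<^bsub>dual_numbers R\<^esub> v = (fst u \<oplus>\<^bsub>R\<^esub> fst v, snd u \<oplus>\<^bsub>R\<^esub> snd v)"
  by (simp_all add: dual_numbers_def)

lemma (in cring) dual_numbers_cring: "cring (dual_numbers R)"
proof (rule cringI)
  show "abelian_group (dual_numbers R)"
  proof (rule abelian_groupI)
    fix x assume "x \<in> carrier (dual_numbers R)"
    then show "\<exists>y\<in>carrier (dual_numbers R). y \<oplus>\<^bsub>dual_numbers R\<^esub> x = \<zero>\<^bsub>dual_numbers R\<^esub>"
      by (intro bexI[of _ "(\<ominus> fst x, \<ominus> snd x)"]) (auto simp: l_neg)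
  qed (auto simp: a_ac)
  show "comm_monoid (dual_numbers R)"
    by (rule comm_monoidI) (auto simp: m_ac a_ac l_distr r_distr)
qed (auto simp: l_distr a_ac)

section \<open>Divisibility of polynomials by a power of the indeterminate\<close>

lemma (in UP_cring) coeff_monom_mult_less:
  assumes "c \<in> carrier R" "p \<in> carrier P" "k < n"
  shows "coeff P (monom P c n \<otimes>\<^bsub>P\<^esub> p) k = \<zero>"
proof -
  have "coeff P (monom P c n \<otimes>\<^bsub>P\<^esub> p) k = (\<Oplus>i\<in>{..k}. \<zero>)"
    using assms unfolding coeff_mult[OF monom_closed[OF assms(1)] assms(2)]
    by (intro R.finsum_cong') auto
  then show ?thesis by simp
qed

text \<open>Elements of \<open>UP R\<close> are sequences that vanish beyond some bound, and
  shifting down preserves the bound. When the first \<open>m\<close> coefficients vanish, the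
  shifted sequence is the quotient of \<open>f\<close> by the monomial of degree
  \<open>m\<close>.\<close>

lemma (in UP_cring) shift_in_carrier:
  assumes "f \<in> carrier P"
  shows "(\<lambda>i. coeff P f (i + m)) \<in> carrier P"
    and "coeff P (\<lambda>i. coeff P f (i + m)) k = coeff P f (k + m)"
proof -
  obtain b where "bound \<zero> b f"
    using assms by (auto simp: P_def UP_def)
  then have "bound \<zero> b (coeff P f)"
    using assms by (simp add: P_def UP_def)
  then have "bound \<zero> b (\<lambda>i. coeff P f (i + m))"
    by (auto simp: bound_def)
  then show 1: "(\<lambda>i. coeff P f (i + m)) \<in> carrier P"
    using assms by (auto simp: P_def UP_def)
  then show "coeff P (\<lambda>i. coeff P f (i + m)) k = coeff P f (k + m)"
    by (simp add: P_def UP_def)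
qed

lemma (in UP_cring) PIdl_monom_one:
  "PIdl\<^bsub>P\<^esub> (monom P \<one> m) = {f \<in> carrier P. \<forall>k<m. coeff P f k = \<zero>}"
proof (intro equalityI subsetI)
  fix f assume "f \<in> PIdl\<^bsub>P\<^esub> (monom P \<one> m)"
  then obtain g where g: "g \<in> carrier P" "f = monom P \<one> m \<otimes>\<^bsub>P\<^esub> g"
    by (auto simp: cgenideal_def UP_m_comm)
  then show "f \<in> {f \<in> carrier P. \<forall>k<m. coeff P f k = \<zero>}"
    by (simp add: coeff_monom_mult_less del: coeff_mult)
next
  fix f assume f: "f \<in> {f \<in> carrier P. \<forall>k<m. coeff P f k = \<zero>}"
  define g where "g = (\<lambda>i. coeff P f (i + m))"
  have g: "g \<in> carrier P" "coeff P g k = coeff P f (k + m)" for k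
    using f unfolding g_def by (auto intro: shift_in_carrier)
  have "f = monom P \<one> m \<otimes>\<^bsub>P\<^esub> g"
  proof (rule up_eqI)
    fix k
    show "coeff P f k = coeff P (monom P \<one> m \<otimes>\<^bsub>P\<^esub> g) k"
    proof (cases "k < m")
      case True
      then show ?thesis using f g by (simp add: coeff_monom_mult_less del: coeff_mult)
    next
      case False
      then show ?thesis
        using f g coeff_monom_mult[OF R.one_closed g(1), of m "k - m"]
        by (simp del: coeff_mult)
    qed
  qed (use f g in auto)
  then show "f \<in> PIdl\<^bsub>P\<^esub> (monom P \<one> m)"
    using g by (auto simp: cgenideal_def UP_m_comm)
qed

text \<open>This is the first isomorphism theorem for the map taking a polynomial to its
  coefficients in degrees 0 and 1.\<close>

lemma (in UP_cring) Quot_monom_2_iso_dual_numbers: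
  "P Quot (PIdl\<^bsub>P\<^esub> (monom P \<one> 2)) \<simeq> dual_numbers R"
proof -
  let ?h = "\<lambda>f. (coeff P f 0, coeff P f 1)"
  interpret D: cring "dual_numbers R" by (rule R.dual_numbers_cring)
  interpret H: ring_hom_ring P "dual_numbers R" ?h
  proof (rule ring_hom_ringI2)
    show "ring P" by (rule UP_ring)
    show "ring (dual_numbers R)" by (rule D.ring_axioms)
    \<comment> \<open>In degrees 0 and 1 the convolution sum has one and two terms, which are the
      two components of the product of dual numbers.\<close>
    show "?h \<in> ring_hom P (dual_numbers R)"
      by (rule ring_hom_memI) (auto simp: atMost_Suc R.a_comm)
  qed
  have "a_kernel P (dual_numbers R) ?h = PIdl\<^bsub>P\<^esub> (monom P \<one> 2)"
    by (auto simp: a_kernel_def' PIdl_monom_one less_2_cases_iff)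
  moreover have "?h ` carrier P = carrier (dual_numbers R)"
  proof (intro equalityI subsetI)
    fix u assume "u \<in> carrier (dual_numbers R)"
    then have "u = ?h (monom P (fst u) 0 \<oplus>\<^bsub>P\<^esub> monom P (snd u) 1)"
      and "monom P (fst u) 0 \<oplus>\<^bsub>P\<^esub> monom P (snd u) 1 \<in> carrier P"
      by auto
    then show "u \<in> ?h ` carrier P" by blast
  qed auto
  ultimately show ?thesis
    using H.FactRing_iso by simp
qed

text \<open>The isomorphism starts at the dual numbers, so that elements of the quotient can be
  treated as images of pairs.\<close>

lemma Zn_poly_mod_x2_iso:
  assumes "n \<ge> 2"
  shows "dual_numbers (residue_ring (int n)) \<simeq> Zn_poly_mod_x2 n"
    and "cring (Zn_poly_mod_x2 n)"
proof -
  interpret Z: residues "int n" "residue_ring (int n)"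
    using assms by unfold_locales auto
  interpret UP_cring "residue_ring (int n)" "UP (residue_ring (int n))"
    by unfold_locales
  interpret I: ideal "PIdl\<^bsub>UP (residue_ring (int n))\<^esub> (monom (UP (residue_ring (int n))) \<one>\<^bsub>residue_ring (int n)\<^esub> 2)"
     "UP (residue_ring (int n))"
    by (intro P.cgenideal_ideal monom_closed Z.one_closed)
  show "cring (Zn_poly_mod_x2 n)"
    unfolding Zn_poly_mod_x2_def Let_def by (rule I.quotient_is_cring[OF UP_cring])
  then have "ring (Zn_poly_mod_x2 n)" by (rule cring.axioms)
  moreover have "Zn_poly_mod_x2 n \<simeq> dual_numbers (residue_ring (int n))"
    unfolding Zn_poly_mod_x2_def Let_def by (rule Quot_monom_2_iso_dual_numbers)
  ultimately show "dual_numbers (residue_ring (int n)) \<simeq> Zn_poly_mod_x2 n"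
    by (rule ring_iso_sym)
qed

section \<open>Residues modulo \<open>n\<close>\<close>

text \<open>Split off the full power of one prime divisor \<open>p\<close>. The cofactor is coprime
  to it, and is not 1 because \<open>n\<close> is no power of \<open>p\<close>.\<close>

lemma not_prime_power_obtain_coprime:
  fixes n :: nat
  assumes "n \<ge> 2" "\<nexists>p k. prime p \<and> k \<ge> 1 \<and> n = p ^ k"
  obtains a b where "n = a * b" "coprime a b" "a > 1" "b > 1"
proof -
  obtain p where p: "prime p" "p dvd n"
    using prime_factor_nat[of n] assms by auto
  obtain b where b: "n = p ^ multiplicity p n * b" "\<not> p dvd b"
    using multiplicity_decompose'[of n p] assms p not_prime_unit by (metis not_numeral_le_zero)
  have m: "multiplicity p n \<ge> 1"
    using p assms by (simp add: Suc_leI prime_multiplicity_gt_zero_iff)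
  then have "b \<noteq> 1" using assms p b(1) by auto
  moreover have "b \<noteq> 0" using b(2) by (intro notI) simp
  moreover have "coprime (p ^ multiplicity p n) b"
    using p b(2) by (simp add: prime_imp_coprime)
  moreover have "p ^ multiplicity p n > 1"
    using p m prime_gt_1_nat by (intro one_less_power) auto
  ultimately show ?thesis using that b(1) by force
qed

text \<open>Take \<open>e\<close> congruent to 1 modulo \<open>a\<close> and to 0 modulo
  \<open>b\<close>. It is idempotent modulo both factors; \<open>a > 1\<close> excludes the value 0
  and \<open>b > 1\<close> the value 1.\<close>

lemma nontrivial_idempotent_mod:
  fixes a b :: nat
  assumes "coprime a b" "a > 1" "b > 1"
  obtains e where "1 < e" "e < a * b" "[e * e = e] (mod (a * b))"
proof -
  obtain x where x: "[x = 1] (mod a)" "[x = 0] (mod b)"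
    using binary_chinese_remainder_nat[OF assms(1)] by blast
  define e where "e = x mod (a * b)"
  have e: "[e = 1] (mod a)" "[e = 0] (mod b)"
    using x by (auto simp: e_def cong_def mod_mult2_eq' mod_mod_cancel)
  have "[e * e = e] (mod a)" "[e * e = e] (mod b)"
    using cong_mult[OF e(1) e(1)] cong_mult[OF e(2) e(2)] e
    by (auto intro: cong_trans cong_sym)
  then have ee: "[e * e = e] (mod (a * b))"
    using assms(1) by (rule coprime_cong_mult_nat)
  have "e \<noteq> 0"
    using e(1) assms by (intro notI) (simp add: cong_def)
  moreover have "e \<noteq> 1"
    using e(2) assms by (intro notI) (simp add: cong_def)
  ultimately have "1 < e" by simp
  moreover have "e < a * b"
    using assms by (simp add: e_def)
  ultimately show ?thesis using ee by (rule that)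
qed

text \<open>The residue \<open>p ^ (k - 1)\<close> generates the smallest nonzero ideal modulo
  \<open>p ^ k\<close>. As \<open>0 < a < p ^ k\<close>, the gcd of \<open>a\<close> and
  \<open>p ^ k\<close> is a power of \<open>p\<close> with exponent below \<open>k\<close>, hence
  divides \<open>p ^ (k - 1)\<close>.\<close>

lemma prime_power_socle:
  fixes a p :: nat
  assumes "prime p" "k \<ge> 1" "0 < a" "a < p ^ k"
  obtains c where "c < p ^ k" "(c * a) mod p ^ k = p ^ (k - 1)"
proof -
  obtain j where j: "gcd a (p ^ k) = p ^ j"
    using iffD1[OF divides_primepow_nat[OF assms(1)] gcd_dvd2] by blast
  have "p ^ j \<le> a" using assms(3) j gcd_le1_nat[of a "p ^ k"] by simp
  then have "p ^ j < p ^ k" using assms(4) by simp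
  then have "j \<le> k - 1"
    using assms(1) prime_gt_1_nat power_less_imp_less_exp by fastforce
  then have "gcd a (p ^ k) dvd p ^ (k - 1)"
    unfolding j by (rule le_imp_power_dvd)
  \<comment> \<open>Bezout makes the gcd a multiple of \<open>a\<close> modulo \<open>p ^ k\<close>;
    scaling reaches \<open>p ^ (k - 1)\<close>.\<close>
  then obtain c where c: "[a * c = p ^ (k - 1)] (mod p ^ k)"
    using cong_solve_nat[of a "p ^ k"] assms(3)
    by (metis cong_scalar_right dvd_def mult.assoc neq0_conv)
  have "p ^ (k - 1) < p ^ k"
    using assms prime_gt_1_nat by (intro power_strict_increasing) auto
  then have "((c mod p ^ k) * a) mod p ^ k = p ^ (k - 1)"
    using c by (simp add: cong_def mod_mult_right_eq mult.commute)
  moreover have "c mod p ^ k < p ^ k" using assms(1) by (simp add: prime_gt_0_nat)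
  ultimately show ?thesis using that by blast
qed

text \<open>For \<open>n = 2\<close> the graph is a single vertex, which counts as connected
  although 2 is a prime power. That case is therefore stated as a vertex count.\<close>

theorem proposition3p15:
  fixes n :: nat
  assumes "n \<ge> 2"
  shows "(n \<noteq> 2 \<longrightarrow>
            (\<not> graph_connected (cozero_divisor_graph (Zn_poly_mod_x2 n)) \<longleftrightarrow>
             (\<exists>p k. prime p \<and> k \<ge> 1 \<and> n = p ^ k)))
       \<and> (n = 2 \<longrightarrow> card (pverts (cozero_divisor_graph (Zn_poly_mod_x2 n))) = 1)"
proof -
  define Z where "Z = residue_ring (int n)"
  define R where "R = Zn_poly_mod_x2 n"
  let ?D = "dual_numbers Z"
  have Z: "carrier Z = {0..int n - 1}" "x \<otimes>\<^bsub>Z\<^esub> y = (x * y) mod int n"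
    "x \<oplus>\<^bsub>Z\<^esub> y = (x + y) mod int n" "\<one>\<^bsub>Z\<^esub> = 1" "\<zero>\<^bsub>Z\<^esub> = 0" for x y
    by (simp_all add: Z_def residue_ring_def)
  interpret R: cring R
    using Zn_poly_mod_x2_iso(2)[OF assms] by (simp add: R_def)
  interpret Z: residues "int n" Z
    using assms by unfold_locales (auto simp: Z_def)
  interpret D: cring ?D by (rule Z.dual_numbers_cring)
  obtain h where h: "h \<in> ring_iso ?D R"
    using Zn_poly_mod_x2_iso(1)[OF assms] by (auto simp: is_ring_iso_def R_def Z_def)
  interpret H: ring_hom_ring ?D R h
    using h by (intro ring_hom_ringI2) (auto simp: ring_iso_def D.ring_axioms R.ring_axioms)
  have bij: "bij_betw h (carrier ?D) (carrier R)"
    using h by (simp add: ring_iso_def)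
  have h_inj: "h u = h v \<longleftrightarrow> u = v" if "u \<in> carrier ?D" "v \<in> carrier ?D" for u v
    using bij that by (auto simp: bij_betw_def inj_on_def)
  have h_surj: "\<exists>u\<in>carrier ?D. v = h u" if "v \<in> carrier R" for v
    using bij_betw_imp_surj_on[OF bij] that by blast
  \<comment> \<open>A nonzero multiple of the nilpotent generator has square zero, so it is not a
    unit.\<close>
  have nilpotent_vertex: "h (0, c) \<in> carrier R - {\<zero>\<^bsub>R\<^esub>} - Units R" if "0 < c" "c < int n" for c
  proof -
    have c: "(0, c) \<in> carrier ?D" using that by (simp add: Z)
    have "h (0, c) \<noteq> \<zero>\<^bsub>R\<^esub>"
      using h_inj[OF c D.zero_closed] that H.hom_zero by (simp add: Z)
    moreover have "h (0, c) \<otimes>\<^bsub>R\<^esub> h (0, c) = \<zero>\<^bsub>R\<^esub>"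
      using H.hom_mult[OF c c] H.hom_zero by (simp add: Z)
    ultimately show ?thesis
      using R.square_zero_not_Unit H.hom_closed[OF c] by blast
  qed
  have "\<not> graph_connected (cozero_divisor_graph R) \<longleftrightarrow> (\<exists>p k. prime p \<and> k \<ge> 1 \<and> n = p ^ k)"
    if "n \<noteq> 2"
  proof
    assume disc: "\<not> graph_connected (cozero_divisor_graph R)"
    show "\<exists>p k. prime p \<and> k \<ge> 1 \<and> n = p ^ k"
    proof (rule ccontr)
      assume "\<nexists>p k. prime p \<and> k \<ge> 1 \<and> n = p ^ k"
      then obtain a b where ab: "n = a * b" "coprime a b" "a > 1" "b > 1"
        using not_prime_power_obtain_coprime[OF assms] by blast
      then obtain e where e: "1 < e" "e < n" "[e * e = e] (mod n)"
        using nontrivial_idempotent_mod by blast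
      have "e * e mod n = e" using e by (simp add: cong_def)
      then have "int e * int e mod int n = int e"
        by (metis of_nat_mult zmod_int)
      \<comment> \<open>The idempotent of the base ring is embedded as a constant;
        \<open>1 < e < n\<close> keeps it apart from zero and one.\<close>
      then have ee: "(int e, 0) \<otimes>\<^bsub>?D\<^esub> (int e, 0) = (int e, 0)" by (simp add: Z)
      have ec: "(int e, 0) \<in> carrier ?D" using e by (simp add: Z)
      have "h (int e, 0) \<noteq> \<zero>\<^bsub>R\<^esub>" "h (int e, 0) \<noteq> \<one>\<^bsub>R\<^esub>"
        using h_inj[OF ec D.zero_closed] h_inj[OF ec D.one_closed] H.hom_zero H.hom_one e
        by (simp_all add: Z)
      then show False
        using disc R.cozero_divisor_graph_connected[of "h (int e, 0)"] H.hom_closed[OF ec]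
          H.hom_mult[OF ec ec] ee by simp
    qed
  next
    assume "\<exists>p k. prime p \<and> k \<ge> 1 \<and> n = p ^ k"
    then obtain p k where p: "prime p" "k \<ge> 1" "n = p ^ k" by blast
    define q where "q = int (p ^ (k - 1))"
    have "p ^ (k - 1) < p ^ k"
      using p prime_gt_1_nat by (intro power_strict_increasing) auto
    then have q: "0 < q" "q < int n"
      unfolding q_def p(3) of_nat_less_iff using p(1) by (simp_all add: prime_gt_0_nat)
    have socle: "\<exists>c\<in>carrier Z. c * a mod int n = q" if "a \<in> carrier Z" "a \<noteq> 0" for a
    proof -
      have "0 < nat a" "nat a < p ^ k" using that unfolding p(3)[symmetric] by (auto simp: Z)
      then obtain c where c: "c < n" "(c * nat a) mod n = p ^ (k - 1)"
        using prime_power_socle[OF p(1,2)] p(3) by metis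
      have "int c * a mod int n = int ((c * nat a) mod n)"
        using that by (simp add: Z zmod_int)
      then show ?thesis using c by (intro bexI[of _ "int c"]) (auto simp: Z q_def)
    qed
    \<comment> \<open>Any nonzero residue other than \<open>q\<close> gives a second vertex. If
      \<open>q = 1\<close>, that is \<open>k = 1\<close>, the choice 2 is below \<open>n\<close>
      because \<open>n \<noteq> 2\<close>.\<close>
    define t where "t = (if q = 1 then 2 else 1 :: int)"
    have t: "0 < t" "t < int n" "t \<noteq> q"
      using assms \<open>n \<noteq> 2\<close> by (auto simp: t_def)
    have qc: "(0, q) \<in> carrier ?D" and tc: "(0, t) \<in> carrier ?D" using q t by (auto simp: Z)
    show "\<not> graph_connected (cozero_divisor_graph R)"
    proof (rule cozero_divisor_graph_not_connected)
      show "h (0, q) \<in> carrier R - {\<zero>\<^bsub>R\<^esub>} - Units R" "h (0, t) \<in> carrier R - {\<zero>\<^bsub>R\<^esub>} - Units R"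
        using nilpotent_vertex q t by blast+
      show "h (0, t) \<noteq> h (0, q)" using h_inj[OF tc qc] t by simp
      fix v assume v: "v \<in> carrier R" "v \<noteq> \<zero>\<^bsub>R\<^esub>"
      then obtain u where u: "u \<in> carrier ?D" "v = h u" using h_surj by blast
      then have "u \<noteq> \<zero>\<^bsub>?D\<^esub>" using v H.hom_zero by auto
      \<comment> \<open>If the constant part of \<open>u\<close> vanishes, a constant factor moves
        the other part to \<open>q\<close>. Otherwise a purely nilpotent factor
        \<open>(0, c)\<close> annihilates the nilpotent part and moves the constant part to
        \<open>q\<close> in the second component.\<close>
      have "\<exists>w\<in>carrier ?D. w \<otimes>\<^bsub>?D\<^esub> u = (0, q)"
      proof (cases "fst u = 0")
        case True
        then have "snd u \<in> carrier Z" "snd u \<noteq> 0"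
          using u \<open>u \<noteq> \<zero>\<^bsub>?D\<^esub>\<close> by (auto simp: Z prod_eq_iff)
        then obtain c where "c \<in> carrier Z" "c * snd u mod int n = q" using socle by blast
        then show ?thesis using True assms by (intro bexI[of _ "(c, 0)"]) (auto simp: Z)
      next
        case False
        then obtain c where "c \<in> carrier Z" "c * fst u mod int n = q"
          using socle[of "fst u"] u by (auto simp: mem_Times_iff)
        then show ?thesis using assms by (intro bexI[of _ "(0, c)"]) (auto simp: Z)
      qed
      then obtain w where w: "w \<in> carrier ?D" "w \<otimes>\<^bsub>?D\<^esub> u = (0, q)" by blast
      then have "h (0, q) = h w \<otimes>\<^bsub>R\<^esub> v" using H.hom_mult[OF w(1) u(1)] u(2) by simp
      then show "h (0, q) \<in> PIdl\<^bsub>R\<^esub> v"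
        using H.hom_closed[OF w(1)] by (auto simp: cgenideal_def)
    qed
  qed
  moreover have "card (pverts (cozero_divisor_graph R)) = 1" if n: "n = 2"
  proof -
    have "x = h (0, 1)" if x: "x \<in> carrier R" "x \<noteq> \<zero>\<^bsub>R\<^esub>" "x \<notin> Units R" for x
    proof -
      obtain u where u: "u \<in> carrier ?D" "x = h u" using h_surj x by blast
      then have "u \<noteq> (0, 0)" using x H.hom_zero by (auto simp: Z)
      moreover have "fst u \<noteq> 1"
      proof
        assume "fst u = 1"
        moreover have "snd u = 0 \<or> snd u = 1" using u n by (auto simp: Z)
        \<comment> \<open>The square of \<open>(1, b)\<close> is \<open>(1, 2 * b)\<close>, which is
          one modulo 2, so \<open>u\<close> is its own inverse.\<close>
        ultimately have "u \<otimes>\<^bsub>?D\<^esub> u = \<one>\<^bsub>?D\<^esub>" using n by (auto simp: Z)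
        then have "x \<otimes>\<^bsub>R\<^esub> x = \<one>\<^bsub>R\<^esub>" using H.hom_mult[OF u(1) u(1)] H.hom_one u(2) by simp
        then show False using x by (auto simp: Units_def)
      qed
      ultimately have "u = (0, 1)" using u n by (cases u) (auto simp: Z)
      then show ?thesis using u by simp
    qed
    then have "pverts (cozero_divisor_graph R) = {h (0, 1)}"
      using nilpotent_vertex[of 1] n by (auto simp: pverts_cozero_divisor_graph)
    then show ?thesis by simp
  qed
  ultimately show ?thesis by (simp add: R_def)
qed

end
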